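(* For all $n\ge 1$, $\mathscr{Z}(K_n)=K_n$.
   Context: All graphs are finite, simple and undirected; equality of graphs here means isomorphism. $K_n$ denotes the complete graph on $n$ vertices. Zero forcing: vertices of a graph $G$ are colored blue or white; the color change rule says that a blue vertex $u$ can change the color of a white vertex $w$ to blue if $w$ is the unique white neighbor of $u$. A set $B\subseteq V(G)$ is a zero forcing set of $G$ if, starting with exactly the vertices of $B$ blue and applying the color change rule repeatedly, all vertices eventually become blue. The zero forcing number $\operatorname{Z}(G)$ is the minimum of $|B|$ over all zero forcing sets $B$ of $G$; a minimum zero forcing set is a zero forcing set $B$ with $|B|=\operatorname{Z}(G)$. The zero forcing graph $\mathscr{Z}(G)$ is the graph whose vertices are the minimum zero forcing sets of $G$, with two of them adjacent if and only if their symmetric difference has exactly two elements. *)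

theory Defs
  imports "Graph_Theory.Graph_Theory"
begin

text \<open>
  Finite simple undirected graphs are the symmetric loop-free digraphs of the locale
  \<^locale>\<open>graph\<close>; an undirected edge is a pair of opposite arcs. The definitions below are
  meant for such graphs.
\<close>

text \<open>
  A single application of the colour change rule, as a relation between sets of blue vertices.
\<close>

definition color_change :: "('a, 'b) pre_digraph \<Rightarrow> 'a set \<Rightarrow> 'a set \<Rightarrow> bool" where
  "color_change G S T \<longleftrightarrow>
     (\<exists>u \<in> S. \<exists>w. {v \<in> verts G - S. u \<rightarrow>\<^bsub>G\<^esub> v} = {w} \<and> T = insert w S)"

definition zero_forcing_set :: "('a, 'b) pre_digraph \<Rightarrow> 'a set \<Rightarrow> bool" where
  "zero_forcing_set G B \<longleftrightarrow> B \<subseteq> verts G \<and> (color_change G)\<^sup>*\<^sup>* B (verts G)"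

definition zero_forcing_number :: "('a, 'b) pre_digraph \<Rightarrow> nat" where
  "zero_forcing_number G = (LEAST k. \<exists>B. zero_forcing_set G B \<and> card B = k)"

definition min_zero_forcing_set :: "('a, 'b) pre_digraph \<Rightarrow> 'a set \<Rightarrow> bool" where
  "min_zero_forcing_set G B \<longleftrightarrow> zero_forcing_set G B \<and> card B = zero_forcing_number G"

definition zero_forcing_graph ::
    "('a, 'b) pre_digraph \<Rightarrow> ('a set, 'a set \<times> 'a set) pre_digraph" where
  "zero_forcing_graph G = with_proj
     \<lparr> pverts = {B. min_zero_forcing_set G B},
       parcs = {(A, B). min_zero_forcing_set G A \<and> min_zero_forcing_set G B
                        \<and> card (sym_diff A B) = 2} \<rparr>"

lemma graph_zero_forcing_graph:
  assumes "graph G"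
  shows "graph (zero_forcing_graph G)"
proof -
  interpret graph G by fact
  let ?V = "{B. min_zero_forcing_set G B}"
  let ?E = "{(A, B). min_zero_forcing_set G A \<and> min_zero_forcing_set G B
                        \<and> card (sym_diff A B) = 2}"
  have "?V \<subseteq> Pow (verts G)"
    by (auto simp: min_zero_forcing_set_def zero_forcing_set_def)
  then have V: "finite ?V"
    by (rule finite_subset) simp
  have E: "finite ?E"
    by (rule finite_subset[of _ "?V \<times> ?V"]) (use V in auto)
  interpret Z: pair_graph "\<lparr> pverts = ?V, parcs = ?E \<rparr>"
    using V E by unfold_locales (auto simp: symmetric_def Un_commute intro!: symI)
  show ?thesis
    unfolding zero_forcing_graph_def by (rule Z.pair_graphD_graph)
qed

end

theory Submission
  imports Defs
begin

text \<open>
  In a complete graph every white vertex is a neighbour of every blue one, so a force happens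
  only when some vertex is blue and exactly one is white. Hence the zero forcing sets of
  \<open>K\<^sub>n\<close> are the vertex sets of size at least \<open>k = max 1 (n - 1)\<close>, and the minimum ones are the
  \<open>k\<close>-subsets, of which there are \<open>n\<close>. As each of them misses at most one vertex, two distinct
  ones differ in exactly two elements, so the zero forcing graph is complete on \<open>n\<close> vertices.
\<close>

text \<open>\<open>digraph_iso\<close> also asks for a map on arcs. Without parallel arcs an arc is
  determined by its ends, so a vertex bijection that matches the end pairs already induces that
  map.\<close>

lemma digraph_isoI_bij_betw:
  assumes "nomulti_digraph G" and "nomulti_digraph H"
    and f: "bij_betw f (verts G) (verts H)"
    and ends: "arcs_ends H = map_prod f f ` arcs_ends G"
  shows "digraph_iso G H"
proof -
  interpret G: nomulti_digraph G by fact
  interpret H: nomulti_digraph H by fact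
  let ?F = "map_prod f f"
  \<comment> \<open>Take an arc to its ends, move these by \<open>f\<close>, and return to the only
    arc of \<open>H\<close> with the resulting ends.\<close>
  define g where "g = the_inv_into (arcs H) (arc_to_ends H) \<circ> ?F \<circ> arc_to_ends G"
  have "bij_betw (arc_to_ends G) (arcs G) (arcs_ends G)"
    using G.inj_on_arc_to_ends by (simp add: bij_betw_def arcs_ends_def)
  moreover have "bij_betw ?F (arcs_ends G) (arcs_ends H)"
    unfolding bij_betw_def ends
  proof (intro conjI refl)
    have "inj_on ?F (verts G \<times> verts G)"
      using f by (intro map_prod_inj_on) (auto simp: bij_betw_def)
    then show "inj_on ?F (arcs_ends G)"
      by (rule inj_on_subset) (auto dest: G.adj_in_verts)
  qed
  moreover have H: "bij_betw (arc_to_ends H) (arcs H) (arcs_ends H)"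
    using H.inj_on_arc_to_ends by (simp add: bij_betw_def arcs_ends_def)
  ultimately have g: "bij_betw g (arcs G) (arcs H)"
    unfolding g_def by (blast intro: bij_betw_trans bij_betw_the_inv_into)
  have ends_g: "arc_to_ends H (g a) = ?F (arc_to_ends G a)" if "a \<in> arcs G" for a
  proof -
    have "?F (arc_to_ends G a) \<in> arc_to_ends H ` arcs H"
      using that ends by (auto simp: arcs_ends_def)
    then show ?thesis
      unfolding g_def by (simp add: f_the_inv_into_f[OF H.inj_on_arc_to_ends])
  qed
  \<comment> \<open>\<open>app_iso\<close> copies head and tail from this record, so choosing those
    of \<open>H\<close> gives equality with \<open>H\<close> as records, also outside the arc
    set.\<close>
  let ?h = "\<lparr>iso_verts = f, iso_arcs = g, iso_head = head H, iso_tail = tail H\<rparr>"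
  have "G.digraph_isomorphism ?h"
    unfolding G.digraph_isomorphism_def
    using f g ends_g G.wf_digraph by (auto simp: bij_betw_def arc_to_ends_def)
  moreover have "H = app_iso ?h G"
    using f g by (intro pre_digraph.equality) (auto simp: bij_betw_def)
  ultimately show ?thesis
    unfolding digraph_iso_def by blast
qed

text \<open>Any vertex bijection works: the end pairs are exactly the off-diagonal ones, and
  injectivity preserves being off the diagonal.\<close>

lemma complete_digraph_iso:
  assumes G: "complete_digraph n G" and H: "complete_digraph n H"
  shows "digraph_iso G H"
proof -
  interpret G: graph G using G by (simp add: complete_digraph_def)
  interpret H: graph H using H by (simp add: complete_digraph_def)
  have "card (verts G) = card (verts H)"
    using G H by (simp add: complete_digraph_def)
  then obtain f where f: "bij_betw f (verts G) (verts H)"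
    using finite_same_card_bij[OF G.finite_verts H.finite_verts] by blast
  have "arcs_ends H = map_prod f f ` arcs_ends G"
  proof -
    have "arcs_ends G = verts G \<times> verts G - Id" "arcs_ends H = verts H \<times> verts H - Id"
      using G H by (auto simp: complete_digraph_def)
    moreover have "verts H = f ` verts G" "inj_on f (verts G)"
      using f by (auto simp: bij_betw_def)
    ultimately show ?thesis
      by (fastforce dest: inj_onD)
  qed
  with f show ?thesis
    by (intro digraph_isoI_bij_betw) unfold_locales
qed

lemma color_change_complete_digraph_iff:
  assumes "complete_digraph n G" and "S \<subseteq> verts G"
  shows "color_change G S T \<longleftrightarrow> S \<noteq> {} \<and> card (verts G - S) = 1 \<and> T = verts G"
proof -
  have white: "{v \<in> verts G - S. u \<rightarrow>\<^bsub>G\<^esub> v} = verts G - S" if "u \<in> S" for u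
    using assms that by (auto simp: complete_digraph_def)
  have "T = insert w S \<longleftrightarrow> T = verts G" if "verts G - S = {w}" for w
    using that assms(2) by blast
  then show ?thesis
    unfolding color_change_def using white by (fastforce simp: card_1_singleton_iff)
qed

text \<open>The \<open>max\<close> matters for \<open>n = 1\<close>: the empty set then has
  \<open>n - 1\<close> elements but contains no blue vertex to force with.\<close>

lemma zero_forcing_set_complete_digraph_iff:
  assumes "complete_digraph n G" and "n \<ge> 1"
  shows "zero_forcing_set G B \<longleftrightarrow> B \<subseteq> verts G \<and> card B \<ge> max 1 (n - 1)"
proof (cases "B \<subseteq> verts G")
  case True
  interpret graph G using assms by (simp add: complete_digraph_def)
  have n: "card (verts G) = n"
    using assms by (simp add: complete_digraph_def)
  have B: "finite B" "card B \<le> n"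
    using finite_subset[OF True] card_mono[OF _ True] n by auto
  have diff: "card (verts G - B) = n - card B"
    using True B n by (simp add: card_Diff_subset)
  have full: "B = verts G \<longleftrightarrow> card B = n"
    using True n card_subset_eq[of "verts G" B] by auto
  \<comment> \<open>The first force already reaches \<open>verts G\<close>, so the closure collapses
    to zero or one steps.\<close>
  have "(color_change G)\<^sup>*\<^sup>* B (verts G) \<longleftrightarrow> B = verts G \<or> color_change G B (verts G)"
  proof
    assume "(color_change G)\<^sup>*\<^sup>* B (verts G)"
    then show "B = verts G \<or> color_change G B (verts G)"
      by (cases rule: converse_rtranclpE)
        (use color_change_complete_digraph_iff[OF assms(1) True] in auto)
  qed auto
  also have "\<dots> \<longleftrightarrow> card B = n \<or> B \<noteq> {} \<and> n - card B = 1"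
    using color_change_complete_digraph_iff[OF assms(1) True] full diff by auto
  also have "\<dots> \<longleftrightarrow> card B \<ge> max 1 (n - 1)"
    using B assms(2) card_gt_0_iff[of B] by auto
  finally show ?thesis
    using True by (simp add: zero_forcing_set_def)
qed (simp add: zero_forcing_set_def)

lemma min_zero_forcing_set_complete_digraph_iff:
  assumes "complete_digraph n G" and "n \<ge> 1"
  shows "min_zero_forcing_set G B \<longleftrightarrow> B \<subseteq> verts G \<and> card B = max 1 (n - 1)"
proof -
  note zf = zero_forcing_set_complete_digraph_iff[OF assms]
  \<comment> \<open>The lower bound on zero forcing sets is attained only if a vertex set of this
    size exists; for \<open>n = 1\<close> this needs a nonempty graph.\<close>
  have "max 1 (n - 1) \<le> card (verts G)"
    using assms by (auto simp: complete_digraph_def)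
  then obtain A where "A \<subseteq> verts G" "card A = max 1 (n - 1)"
    by (rule obtain_subset_with_card_n)
  then have "zero_forcing_number G = max 1 (n - 1)"
    unfolding zero_forcing_number_def by (intro Least_equality) (auto simp: zf)
  then show ?thesis
    by (auto simp: min_zero_forcing_set_def zf)
qed

text \<open>Equal cardinalities make \<open>A - B\<close> and \<open>B - A\<close> equally large,
  and \<open>A - B\<close> lies in \<open>V - B\<close>, which has at most one element. So both
  differences are empty or both are singletons.\<close>

lemma card_sym_diff_eq_2_iff:
  assumes "finite V" "A \<subseteq> V" "B \<subseteq> V" "card A = card B" "card V \<le> card B + 1"
  shows "card (sym_diff A B) = 2 \<longleftrightarrow> A \<noteq> B"
proof
  assume "A \<noteq> B"
  have fin: "finite A" "finite B"
    using assms finite_subset by auto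
  have eq: "card (A - B) = card (B - A)"
    using fin assms(4) by (simp add: card_le_sym_Diff dual_order.antisym)
  have "card (A - B) \<le> card (V - B)"
    using assms by (intro card_mono) auto
  also have "\<dots> \<le> 1"
    using assms fin by (simp add: card_Diff_subset)
  finally have "card (A - B) \<le> 1" .
  moreover have "card (A - B) \<noteq> 0"
    using \<open>A \<noteq> B\<close> eq fin by (metis Diff_eq_empty_iff card_0_eq finite_Diff subset_antisym)
  ultimately have "card (A - B) = 1" "card (B - A) = 1"
    using eq by auto
  then show "card (sym_diff A B) = 2"
    using fin by (subst card_Un_disjoint) auto
qed auto

lemma complete_digraph_zero_forcing_graph:
  assumes "complete_digraph n G" and "n \<ge> 1"
  shows "complete_digraph n (zero_forcing_graph G)"
proof -
  interpret graph G using assms by (simp add: complete_digraph_def)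
  let ?k = "max 1 (n - 1)"
  let ?M = "{B. min_zero_forcing_set G B}"
  note min_iff = min_zero_forcing_set_complete_digraph_iff[OF assms]
  have n: "card (verts G) = n"
    using assms by (simp add: complete_digraph_def)
  have M: "?M = {B. B \<subseteq> verts G \<and> card B = ?k}"
    by (simp only: min_iff)
  have "finite ?M"
    unfolding M by simp
  moreover have "card ?M = n"
  proof -
    have "card ?M = n choose ?k"
      unfolding M using n by (simp only: n_subsets finite_verts)
    \<comment> \<open>For \<open>n = 1\<close> this is \<open>1 choose 1\<close>; otherwise symmetry
      turns \<open>n choose (n - 1)\<close> into \<open>n choose 1\<close>.\<close>
    also have "\<dots> = n"
      using assms(2) by (cases "n = 1") (auto simp: max_def binomial_symmetric[of "n - Suc 0" n])
    finally show ?thesis .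
  qed
  moreover have "card (sym_diff A B) = 2 \<longleftrightarrow> A \<noteq> B" if "A \<in> ?M" "B \<in> ?M" for A B
    using that n by (intro card_sym_diff_eq_2_iff[of "verts G"]) (auto simp: min_iff)
  ultimately show ?thesis
    unfolding zero_forcing_graph_def complete_digraph_pair_def by auto
qed

theorem proposition2p3:
  fixes n :: nat
    and G :: "('a, 'b) pre_digraph"
    and H :: "('c, 'd) pre_digraph"
  assumes "n \<ge> 1"
    and "complete_digraph n G"
    and "complete_digraph n H"
  shows "digraph_iso (zero_forcing_graph G) H"
  using complete_digraph_iso[OF complete_digraph_zero_forcing_graph] assms by blast

end
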